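(* There are infinitely many $n \in \mathbb{N} \setminus \mathbb{P}$ such that $n - n_* \notin 2\mathbb{P}$ and $n - n_{**} \notin 2\mathbb{P}$.
   Context: $\mathbb{N}$ denotes the natural numbers including $0$. Every $n \in \mathbb{N}$ has a unique decimal representation $n = \sum_{j=0}^{h(n)} n_j \cdot 10^j$ with minimal $h(n) \in \mathbb{N}$ and digits $n_0,\dots,n_{h(n)} \in \{0,\dots,9\}$ (no leading zeros, except that $0$ is represented by the single digit $0$). A natural number $n$ is called palindromic iff $n_j = n_{h(n)-j}$ for all $0 \le j \le h(n)$. $\mathbb{P} = \{0,1,2,\dots,9,11,22,\dots,99,101,111,121,\dots\}$ denotes the set of palindromic natural numbers; in particular $0 \in \mathbb{P}$. $2\mathbb{P} = \{p+q : p,q \in \mathbb{P}\}$ is the set of sums of two (not necessarily distinct) elements of $\mathbb{P}$. For $n \in \mathbb{N}$, $n_* := \max\{p \in \mathbb{P} : p < n\}$ is the palindromic precursor of $n$ (defined for $n \geq 1$), and $n_{**} := (n_* )_*$ (defined for $n\ge 2$; every $n \in \mathbb{N}\setminus\mathbb{P}$ satisfies $n \ge 10$, so both are defined for such $n$). *)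

theory Defs
  imports Main
begin

definition dec_digit :: "nat \<Rightarrow> nat \<Rightarrow> nat" where
  "dec_digit n j = n div 10 ^ j mod 10"

(* Index of the leading digit, one less than the number of digits; it is 0 for n = 0,
   so that 0 is written with the single digit 0. *)
definition top_index :: "nat \<Rightarrow> nat" where
  "top_index n = (LEAST h. n = (\<Sum>j=0..h. dec_digit n j * 10 ^ j))"

definition palindromic :: "nat \<Rightarrow> bool" where
  "palindromic n \<longleftrightarrow> (\<forall>j\<le>top_index n. dec_digit n j = dec_digit n (top_index n - j))"

definition palindromes :: "nat set" where
  "palindromes = {n. palindromic n}"

definition palindrome_sums :: "nat set" where
  "palindrome_sums = {p + q | p q. p \<in> palindromes \<and> q \<in> palindromes}"

(* Max is taken over a finite set, nonempty for n \<ge> 1 because 0 is palindromic;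
   the value at n = 0 is unspecified. *)
definition precursor :: "nat \<Rightarrow> nat" where
  "precursor n = Max {p \<in> palindromes. p < n}"

end

theory Submission
  imports Defs
begin

text \<open>
  Around \<open>2 * 10 ^ k\<close> two palindromes lie unusually close together: \<open>20...02\<close> and, just below it,
  \<open>19...91\<close>, which are only 11 apart, whereas the next palindrome above is far away. On the other
  hand, two-digit palindromes are the multiples of 11, so adding a one-digit palindrome to one of
  them never leaves remainder 10 modulo 11; hence none of 21, 32, ..., 98 is a sum of two
  palindromes. As these exceptional values are also spaced by 11, the number
  \<open>n = 2 * 10 ^ k + 23\<close> has precursor \<open>2 * 10 ^ k + 2\<close> at distance 21 and second precursor
  \<open>2 * 10 ^ k - 9\<close> at distance 32, neither of which is a sum of two palindromes. This works for every
  \<open>k \<ge> 3\<close>.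

  The two lemmas that carry the argument are \<open>not_palindrome_sum_if_mod_11\<close> and
  \<open>palindromic_above_two_power_iff\<close>; the latter locates the first precursor. For the second one, a
  palindrome just below \<open>2 * 10 ^ k\<close> begins with 1 and so must end in 1.
\<close>

section \<open>Digits and palindromes\<close>

text \<open>The digits of \<open>n\<close> at positions up to \<open>h\<close> spell \<open>n mod 10 ^ Suc h\<close>, so they represent \<open>n\<close>
  exactly from the first \<open>h\<close> with \<open>n < 10 ^ Suc h\<close> on.\<close>

lemma sum_dec_digit: "(\<Sum>j=0..h. dec_digit n j * 10 ^ j) = n mod 10 ^ Suc h"
proof (induction h)
  case 0
  then show ?case by (simp add: dec_digit_def)
next
  case (Suc h)
  have "n mod (10 ^ Suc h * 10) = 10 ^ Suc h * (n div 10 ^ Suc h mod 10) + n mod 10 ^ Suc h"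
    by (rule mod_mult2_eq)
  with Suc show ?case
    by (simp add: dec_digit_def mult.commute)
qed

lemma top_index_eqI:
  assumes "10 ^ h \<le> n" "n < 10 ^ Suc h"
  shows "top_index n = h"
  unfolding top_index_def
proof (rule Least_equality)
  show "n = (\<Sum>j=0..h. dec_digit n j * 10 ^ j)"
    using assms(2) by (simp add: sum_dec_digit)
next
  fix i
  assume "n = (\<Sum>j=0..i. dec_digit n j * 10 ^ j)"
  then have "n = n mod 10 ^ Suc i"
    by (simp only: sum_dec_digit)
  then have "n < 10 ^ Suc i"
    by (metis mod_less_divisor zero_less_numeral zero_less_power)
  with assms(1) have "(10::nat) ^ h < 10 ^ Suc i"
    by (rule le_less_trans)
  then show "h \<le> i"
    by (simp del: power_Suc)
qed

lemma palindromic_iff_dec_digits: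
  assumes "10 ^ h \<le> n" "n < 10 ^ Suc h"
  shows "palindromic n \<longleftrightarrow> (\<forall>j\<le>h. dec_digit n j = dec_digit n (h - j))"
  unfolding palindromic_def top_index_eqI[OF assms] ..

lemma palindromic_last_eq_leading:
  assumes "palindromic n" "10 ^ h \<le> n" "n < 10 ^ Suc h"
  shows "n mod 10 = n div 10 ^ h"
proof -
  have "dec_digit n 0 = dec_digit n h"
    using assms(1) unfolding palindromic_iff_dec_digits[OF assms(2,3)]
    by (metis diff_zero zero_le)
  moreover have "n div 10 ^ h < 10"
    using assms(3) by (simp add: less_mult_imp_div_less)
  ultimately show ?thesis
    by (simp add: dec_digit_def)
qed

lemma precursor_eqI:
  assumes "palindromic p" "p < n" "\<And>q. palindromic q \<Longrightarrow> q < n \<Longrightarrow> q \<le> p"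
  shows "precursor n = p"
  unfolding precursor_def
  by (rule Max_eqI) (use assms in \<open>auto simp: palindromes_def\<close>)

section \<open>Two-digit numbers that are not sums of two palindromes\<close>

lemma palindromic_less_100_cases:
  assumes "palindromic n" "n < 100"
  shows "n < 10 \<or> n mod 11 = 0"
proof (rule disjCI)
  assume "n mod 11 \<noteq> 0"
  show "n < 10"
  proof (rule ccontr)
    assume "\<not> n < 10"
    then have "n mod 10 = n div 10"
      using palindromic_last_eq_leading[of n 1] assms by simp
    then have "n = 11 * (n div 10)"
      by presburger
    with \<open>n mod 11 \<noteq> 0\<close> show False
      by (metis mod_mult_self1_is_0)
  qed
qed

text \<open>Modulo 11 a summand below 100 is either 0 or its own single digit, which is at most 9. So
  remainder 10 needs two single digits, whose sum is at most 18; the lower bound 21 excludes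
  the one remaining case 10.\<close>

lemma not_palindrome_sum_if_mod_11:
  assumes "21 \<le> n" "n < 100" "n mod 11 = 10"
  shows "n \<notin> palindrome_sums"
proof
  assume "n \<in> palindrome_sums"
  then obtain p q where n: "n = p + q" and "palindromic p" "palindromic q"
    by (auto simp: palindrome_sums_def palindromes_def)
  with assms(2) have "p < 10 \<or> p mod 11 = 0" "q < 10 \<or> q mod 11 = 0"
    by (simp_all add: palindromic_less_100_cases)
  moreover have "n mod 11 = (p mod 11 + q mod 11) mod 11"
    unfolding n by (simp add: mod_add_eq)
  ultimately have "p < 10 \<and> q < 10"
    using assms(3) by auto
  with assms(1) n show False
    by simp
qed

section \<open>Palindromes near twice a power of ten\<close>

lemma div_power_above_two_power:
  fixes c :: nat
  assumes "c < 10 ^ j" "j \<le> k"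
  shows "(2 * 10 ^ k + c) div 10 ^ j = 2 * 10 ^ (k - j)"
proof -
  have "2 * 10 ^ k + c = 2 * 10 ^ (k - j) * 10 ^ j + c"
    using assms(2) by (simp flip: power_add)
  then show ?thesis
    using assms(1) by (simp only: div_mult_self3) simp
qed

text \<open>The digits at positions \<open>k\<close> and \<open>k - 1\<close> of \<open>2 * 10 ^ k + c\<close> are 2 and 0, so a palindrome of
  this form has \<open>c = 02\<close>.\<close>

lemma palindromic_above_two_power_iff:
  assumes "3 \<le> k" "c < 100"
  shows "palindromic (2 * 10 ^ k + c) \<longleftrightarrow> c = 2"
proof -
  let ?n = "2 * 10 ^ k + c"
  have small: "c < 10 ^ j" if "2 \<le> j" for j
    using power_increasing[OF that, of "10::nat"] assms(2) by simp
  have "10 ^ k \<le> ?n" "?n < 10 ^ Suc k"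
    using small[of k] assms(1) by simp_all
  note iff = palindromic_iff_dec_digits[OF this]
  have high: "dec_digit ?n j = (if j = k then 2 else 0)" if "c < 10 ^ j" "j \<le> k" for j
    using that by (cases "k - j") (simp_all add: dec_digit_def div_power_above_two_power)
  have split: "?n = 10 * (10 * (2 * 10 ^ (k - 2))) + c"
  proof -
    obtain m where "k = 3 + m"
      using assms(1) le_Suc_ex by blast
    then show ?thesis by (simp add: power_add)
  qed
  have digit0: "dec_digit ?n 0 = c mod 10"
    unfolding split dec_digit_def by (simp only: power_0 div_by_1 mod_mult_self4)
  have digit1: "dec_digit ?n 1 = c div 10"
    using assms(2) unfolding split dec_digit_def
    by (simp only: power_one_right div_mult_self4 mod_mult_self4) simp
  show ?thesis
  proof
    assume "palindromic ?n"
    then have sym: "dec_digit ?n j = dec_digit ?n (k - j)" if "j \<le> k" for j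
      using that iff by blast
    have "c mod 10 = 2"
      using sym[of 0] high[of k] small[of k] digit0 assms(1) by simp
    moreover have "k - 1 \<noteq> k" "2 \<le> k - 1"
      using assms(1) by simp_all
    then have "c div 10 = 0"
      using sym[of 1] high[of "k - 1"] small[of "k - 1"] digit1 assms(1) by simp
    ultimately show "c = 2"
      by presburger
  next
    assume [simp]: "c = 2"
    have "dec_digit ?n j = (if j = 0 \<or> j = k then 2 else 0)" if "j \<le> k" for j
    proof (cases "j = 0")
      case False
      then have "(10::nat) ^ 1 \<le> 10 ^ j"
        by (intro power_increasing) auto
      with high[OF _ that] False show ?thesis by simp
    qed (use digit0 in simp)
    then show "palindromic ?n"
      unfolding iff by auto
  qed
qed

text \<open>This number is written \<open>19...91\<close>.\<close>

lemma palindromic_two_power_minus_9: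
  assumes "1 \<le> k"
  shows "palindromic (2 * 10 ^ k - 9)"
proof -
  let ?n = "2 * 10 ^ k - 9 :: nat"
  have ten: "10 \<le> (10::nat) ^ j" if "1 \<le> j" for j
    using power_increasing[OF that, of "10::nat"] by simp
  have "10 ^ k \<le> ?n" "?n < 10 ^ Suc k"
    using ten[OF assms] by simp_all
  note iff = palindromic_iff_dec_digits[OF this]
  have digits: "dec_digit ?n j = (if j = 0 \<or> j = k then 1 else 9)" if "j \<le> k" for j
  proof (cases "j = 0")
    case True
    have "2 * 10 ^ k - 9 = 10 * (2 * 10 ^ (k - 1) - 1) + (1::nat)"
    proof -
      have "10 ^ k = 10 * (10::nat) ^ (k - 1)" "1 \<le> (10::nat) ^ (k - 1)"
        using assms by (simp_all flip: power_Suc)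
      then show ?thesis by arith
    qed
    then show ?thesis
      using True by (simp add: dec_digit_def mod_Suc)
  next
    case False
    then have j: "1 \<le> j" by simp
    have "10 ^ k = 10 ^ (k - j) * (10::nat) ^ j"
      using that by (simp flip: power_add)
    \<comment> \<open>Subtracting 9 borrows exactly 1 from the part above position \<open>j\<close>.\<close>
    then have "?n = (2 * 10 ^ (k - j) - 1) * 10 ^ j + (10 ^ j - 9)"
      using ten[OF j] by (simp add: diff_mult_distrib)
    then have div_eq: "?n div 10 ^ j = 2 * 10 ^ (k - j) - 1"
      using ten[OF j] by (simp only: div_mult_self3) simp
    show ?thesis
    proof (cases "j = k")
      case True
      with div_eq False show ?thesis by (simp add: dec_digit_def)
    next
      case neq: False
      with that obtain i where "k - j = Suc i"
        by (metis Suc_diff_Suc le_neq_implies_less)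
      then have "?n div 10 ^ j = 10 * (2 * 10 ^ i - 1) + 9"
        using div_eq by (simp add: diff_mult_distrib2)
      then have "dec_digit ?n j = 9"
        unfolding dec_digit_def by (simp only: mod_mult_self4) simp
      with neq False show ?thesis by simp
    qed
  qed
  show ?thesis
    unfolding iff using digits by auto
qed

lemma precursor_two_power_plus_23:
  assumes "3 \<le> k"
  shows "precursor (2 * 10 ^ k + 23) = 2 * 10 ^ k + 2"
proof (rule precursor_eqI)
  show "palindromic (2 * 10 ^ k + 2)"
    using palindromic_above_two_power_iff[of k 2] assms by simp
next
  fix q :: nat
  assume q: "palindromic q" "q < 2 * 10 ^ k + 23"
  show "q \<le> 2 * 10 ^ k + 2"
  proof (rule ccontr)
    assume "\<not> q \<le> 2 * 10 ^ k + 2"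
    then obtain c where c: "q = 2 * 10 ^ k + c" "c \<noteq> 2"
      using le_Suc_ex[of "2 * 10 ^ k" q] by auto
    with q palindromic_above_two_power_iff[of k c] assms show False
      by simp
  qed
qed simp

lemma precursor_two_power_plus_2:
  assumes "3 \<le> k"
  shows "precursor (2 * 10 ^ k + 2) = 2 * 10 ^ k - 9"
proof (rule precursor_eqI)
  show "palindromic (2 * 10 ^ k - 9)"
    using palindromic_two_power_minus_9 assms by simp
next
  fix q :: nat
  assume q: "palindromic q" "q < 2 * 10 ^ k + 2"
  show "q \<le> 2 * 10 ^ k - 9"
  proof (rule ccontr)
    assume gt: "\<not> q \<le> 2 * 10 ^ k - 9"
    have ten: "10 \<le> (10::nat) ^ k"
      using power_increasing[of 1 k "10::nat"] assms by simp
    show False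
    proof (cases "2 * 10 ^ k \<le> q")
      case True
      then obtain c where "q = 2 * 10 ^ k + c"
        using le_Suc_ex by blast
      with q palindromic_above_two_power_iff[of k c] assms show False
        by simp
    next
      case False
      have "q div 10 ^ k = 1"
        using False gt ten by (intro div_nat_eqI) auto
      then have last: "q mod 10 = 1"
        using palindromic_last_eq_leading[of q k] q(1) False gt ten by simp
      have tens: "10 ^ k = 10 * (10::nat) ^ (k - 1)"
        using assms by (cases k) auto
      \<comment> \<open>The eight numbers strictly between \<open>19...91\<close> and \<open>20...00\<close> end in 2, ..., 9.\<close>
      have q_eq: "q = 10 * (q div 10) + 1"
        using mult_div_mod_eq[of 10 q] unfolding last by simp
      have "q div 10 < 2 * 10 ^ (k - 1)"
        using q_eq False unfolding tens by linarith
      moreover have "2 * 10 ^ (k - 1) < q div 10 + 1"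
        using q_eq gt ten unfolding tens by linarith
      ultimately show False
        by simp
    qed
  qed
qed simp

section \<open>The infinite family\<close>

theorem proposition3:
  shows "infinite {n :: nat. n \<notin> palindromes
    \<and> n - precursor n \<notin> palindrome_sums
    \<and> n - precursor (precursor n) \<notin> palindrome_sums}"
    (is "infinite ?S")
proof
  assume "finite ?S"
  moreover have "(\<lambda>k. 2 * 10 ^ k + 23) ` {3..} \<subseteq> ?S"
  proof (rule image_subsetI)
    fix k :: nat
    assume "k \<in> {3..}"
    then have k: "3 \<le> k" by simp
    let ?n = "2 * 10 ^ k + 23 :: nat"
    have "?n \<notin> palindromes"
      using palindromic_above_two_power_iff[OF k, of 23] by (simp add: palindromes_def)
    moreover have "?n - precursor ?n = 21"
      using precursor_two_power_plus_23[OF k] by simp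
    moreover have "?n - precursor (precursor ?n) = 32"
    proof -
      have "10 \<le> (10::nat) ^ k"
        using power_increasing[of 1 k "10::nat"] k by simp
      then show ?thesis
        using precursor_two_power_plus_23[OF k] precursor_two_power_plus_2[OF k] by simp
    qed
    ultimately show "?n \<in> ?S"
      using not_palindrome_sum_if_mod_11[of 21] not_palindrome_sum_if_mod_11[of 32] by simp
  qed
  ultimately have "finite ((\<lambda>k. 2 * 10 ^ k + 23 :: nat) ` {3..})"
    by (rule rev_finite_subset)
  then have "finite {3::nat..}"
    by (rule finite_imageD) (simp add: inj_on_def)
  then show False
    using infinite_Ici by blast
qed

end
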